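(* Let $D$ be a finite set, let $M\in\{0,1,*\}^{D\times D}$ be a symmetric matrix and let $C\colon D\to\mathbb{Z}_{\geq 0}$ be a function. Then the problem #$C$-$M$-partitions is polynomial-time Turing reducible to the problem #List-$M$-partitions.
   Context: For a symmetric matrix $M\in\{0,1,*\}^{D\times D}$ and an undirected graph $G=(V,E)$ (no loops), an $M$-partition of $G$ is a function $\sigma\colon V\to D$ such that, for all distinct $u,v\in V$: $M_{\sigma(u),\sigma(v)}\neq 0$ if $(u,v)\in E$, and $M_{\sigma(u),\sigma(v)}\neq 1$ if $(u,v)\notin E$. Let $\mathcal{P}(D)$ be the powerset of $D$. Given $L\colon V(G)\to\mathcal{P}(D)$, $\sigma$ respects $L$ if $\sigma(v)\in L(v)$ for all $v\in V(G)$. Problem #List-$M$-partitions ($M$ fixed). Input: a pair $(G,L)$ where $G$ is a graph and $L\colon V(G)\to\mathcal{P}(D)$. Output: the number of $M$-partitions of $G$ that respect $L$. A cardinality constraint is a function $C\colon D\to\mathbb{Z}_{\geq 0}$. An $M$-partition $\sigma$ of $G$ satisfies $C$ if $|\{v\in V(G)\mid\sigma(v)=d\}|\geq C(d)$ for each $d\in D$. Problem #$C$-$M$-partitions ($C$ and $M$ fixed parameters, not part of the input). Input: a graph $G$. Output: the number of $M$-partitions of $G$ that satisfy $C$. A counting problem $P$ is polynomial-time Turing reducible to a counting problem $Q$ if there is a polynomial-time deterministic oracle Turing machine that, on every instance $x$ of $P$, outputs $P(x)$ by making queries to an oracle for $Q$. *)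

theory Defs
  imports
    "HOL-Library.FuncSet"
    "HOL-Computational_Algebra.Polynomial"
    "Graph_Theory.Pair_Digraph"
begin

section \<open>\<open>M\<close>-partitions\<close>

datatype entry = Zero | One | Star

definition symmetric_matrix :: "'d set \<Rightarrow> ('d \<Rightarrow> 'd \<Rightarrow> entry) \<Rightarrow> bool" where
  "symmetric_matrix D M \<longleftrightarrow> (\<forall>i\<in>D. \<forall>j\<in>D. M i j = M j i)"

text \<open>
  An undirected graph without loops is a \<^locale>\<open>pair_graph\<close>: a finite vertex set with a symmetric
  and irreflexive set of arcs.  Maps defined on the vertex set are kept extensional, so that
  distinct maps are distinct as HOL functions and cardinalities count what they should.
\<close>

definition M_partition ::
    "'d set \<Rightarrow> ('d \<Rightarrow> 'd \<Rightarrow> entry) \<Rightarrow> 'v pair_pre_digraph \<Rightarrow> ('v \<Rightarrow> 'd) \<Rightarrow> bool" where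
  "M_partition D M G \<sigma> \<longleftrightarrow>
     \<sigma> \<in> pverts G \<rightarrow>\<^sub>E D \<and>
     (\<forall>u\<in>pverts G. \<forall>v\<in>pverts G. u \<noteq> v \<longrightarrow>
        ((u, v) \<in> parcs G \<longrightarrow> M (\<sigma> u) (\<sigma> v) \<noteq> Zero) \<and>
        ((u, v) \<notin> parcs G \<longrightarrow> M (\<sigma> u) (\<sigma> v) \<noteq> One))"

definition respects_lists :: "'v pair_pre_digraph \<Rightarrow> ('v \<Rightarrow> 'd set) \<Rightarrow> ('v \<Rightarrow> 'd) \<Rightarrow> bool" where
  "respects_lists G L \<sigma> \<longleftrightarrow> (\<forall>v\<in>pverts G. \<sigma> v \<in> L v)"

definition satisfies_constraint ::
    "'d set \<Rightarrow> 'v pair_pre_digraph \<Rightarrow> ('d \<Rightarrow> nat) \<Rightarrow> ('v \<Rightarrow> 'd) \<Rightarrow> bool" where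
  "satisfies_constraint D G C \<sigma> \<longleftrightarrow> (\<forall>d\<in>D. card {v \<in> pverts G. \<sigma> v = d} \<ge> C d)"


section \<open>Counting problems\<close>

text \<open>A counting problem comes with an encoding of its instances as bit strings.\<close>

record 'i counting_problem =
  instances :: "'i set"
  encode :: "'i \<Rightarrow> bool list"
  solution_count :: "'i \<Rightarrow> nat"

text \<open>Binary notation, least significant bit first and without leading zeros; \<open>0\<close> is the empty word.\<close>

fun binary :: "nat \<Rightarrow> bool list" where
  "binary n = (if n = 0 then [] else odd n # binary (n div 2))"

declare binary.simps [simp del]

text \<open>
  As usual for encodings, the vertices of an input graph are numbered \<open>0, \<dots>, n - 1\<close>.  The graph is
  encoded by \<open>n\<close> in unary, a separator, and its adjacency matrix row by row.  The lists are encoded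
  vertex by vertex as characteristic vectors of subsets of \<open>D\<close>, relative to a fixed enumeration
  of \<open>D\<close>.
\<close>

definition input_graphs :: "nat pair_pre_digraph set" where
  "input_graphs = {G. pair_graph G \<and> (\<exists>n. pverts G = {..<n})}"

definition encode_graph :: "nat pair_pre_digraph \<Rightarrow> bool list" where
  "encode_graph G = (let n = card (pverts G) in
     replicate n True @ False #
     map (\<lambda>e. e \<in> parcs G) (List.product [0..<n] [0..<n]))"

definition enumeration :: "'d set \<Rightarrow> 'd list" where
  "enumeration D = (SOME ds. distinct ds \<and> set ds = D)"

definition encode_lists :: "'d set \<Rightarrow> nat \<Rightarrow> (nat \<Rightarrow> 'd set) \<Rightarrow> bool list" where
  "encode_lists D n L = concat (map (\<lambda>v. map (\<lambda>d. d \<in> L v) (enumeration D)) [0..<n])"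

definition List_M_partitions ::
    "'d set \<Rightarrow> ('d \<Rightarrow> 'd \<Rightarrow> entry) \<Rightarrow>
     (nat pair_pre_digraph \<times> (nat \<Rightarrow> 'd set)) counting_problem" where
  "List_M_partitions D M =
    \<lparr> instances = {(G, L). G \<in> input_graphs \<and> L \<in> pverts G \<rightarrow>\<^sub>E Pow D},
      encode = (\<lambda>(G, L). encode_graph G @ encode_lists D (card (pverts G)) L),
      solution_count = (\<lambda>(G, L). card {\<sigma>. M_partition D M G \<sigma> \<and> respects_lists G L \<sigma>}) \<rparr>"

definition C_M_partitions ::
    "'d set \<Rightarrow> ('d \<Rightarrow> nat) \<Rightarrow> ('d \<Rightarrow> 'd \<Rightarrow> entry) \<Rightarrow>
     nat pair_pre_digraph counting_problem" where
  "C_M_partitions D C M =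
    \<lparr> instances = input_graphs,
      encode = encode_graph,
      solution_count = (\<lambda>G. card {\<sigma>. M_partition D M G \<sigma> \<and> satisfies_constraint D G C \<sigma>}) \<rparr>"


section \<open>Deterministic oracle Turing machines\<close>

text \<open>
  Multitape machines with two-way infinite tapes.  A tape is its content together with the head
  position.  Tape \<open>0\<close> carries the input, tape \<open>1\<close> is the oracle tape, tape \<open>2\<close> carries the output,
  and all further tapes are work tapes; every tape may be read and written.  The symbol \<open>0\<close> is the
  blank, and \<open>1\<close> and \<open>2\<close> stand for the bits \<^const>\<open>False\<close> and \<^const>\<open>True\<close>.
\<close>

datatype direction = Move_Left | Stay | Move_Right

type_synonym tape = "(int \<Rightarrow> nat) \<times> int"

type_synonym configuration = "nat \<times> tape list"

record oracle_machine =
  tape_number :: nat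
  alphabet :: "nat set"
  states :: "nat set"
  start_state :: nat
  halt_state :: nat
  query_state :: nat
  answer_state :: nat
  transition :: "nat \<Rightarrow> nat list \<Rightarrow> nat \<times> (nat \<times> direction) list"

definition wf_oracle_machine :: "oracle_machine \<Rightarrow> bool" where
  "wf_oracle_machine T \<longleftrightarrow>
     3 \<le> tape_number T \<and>
     finite (alphabet T) \<and> {0, 1, 2} \<subseteq> alphabet T \<and>
     finite (states T) \<and>
     {start_state T, halt_state T, query_state T, answer_state T} \<subseteq> states T \<and>
     halt_state T \<noteq> query_state T \<and>
     (\<forall>q \<in> states T. \<forall>ss. length ss = tape_number T \<and> set ss \<subseteq> alphabet T \<longrightarrow>
        (case transition T q ss of (q', acts) \<Rightarrow>
           q' \<in> states T \<and> length acts = tape_number T \<and> fst ` set acts \<subseteq> alphabet T))"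

definition word_on_tape :: "bool list \<Rightarrow> int \<Rightarrow> nat" where
  "word_on_tape w i =
     (if 0 \<le> i \<and> i < int (length w) then (if w ! nat i then 2 else 1) else 0)"

fun read_tape :: "tape \<Rightarrow> nat" where
  "read_tape (f, h) = f h"

fun act_on_tape :: "nat \<times> direction \<Rightarrow> tape \<Rightarrow> tape" where
  "act_on_tape (s, m) (f, h) =
     (f(h := s), case m of Move_Left \<Rightarrow> h - 1 | Stay \<Rightarrow> h | Move_Right \<Rightarrow> h + 1)"

text \<open>
  In the query state, the oracle tape has to contain exactly the encoding of an instance of the
  oracle problem \<open>Q\<close> (the machine is stuck otherwise).  In one step, this encoding is replaced by
  the solution count in binary, the head of the oracle tape returns to cell \<open>0\<close>, and the answer
  state is entered.
\<close>

inductive machine_step ::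
    "oracle_machine \<Rightarrow> 'i counting_problem \<Rightarrow> configuration \<Rightarrow> configuration \<Rightarrow> bool"
  for T :: oracle_machine and Q :: "'i counting_problem" where
  ordinary:
    "\<lbrakk>q \<noteq> halt_state T; q \<noteq> query_state T;
      transition T q (map read_tape ts) = (q', acts)\<rbrakk> \<Longrightarrow>
     machine_step T Q (q, ts) (q', map2 act_on_tape acts ts)"
| query:
    "\<lbrakk>q = query_state T; y \<in> instances Q; fst (ts ! 1) = word_on_tape (encode Q y)\<rbrakk> \<Longrightarrow>
     machine_step T Q (q, ts)
       (answer_state T, ts[1 := (word_on_tape (binary (solution_count Q y)), 0)])"

definition initial_configuration :: "oracle_machine \<Rightarrow> bool list \<Rightarrow> configuration" where
  "initial_configuration T w =
     (start_state T, (word_on_tape w, 0) # replicate (tape_number T - 1) (\<lambda>_. 0, 0))"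

definition computes_within ::
    "oracle_machine \<Rightarrow> 'i counting_problem \<Rightarrow> bool list \<Rightarrow> nat \<Rightarrow> nat \<Rightarrow> bool" where
  "computes_within T Q w a b \<longleftrightarrow>
     (\<exists>t ts. t \<le> b \<and>
        (machine_step T Q ^^ t) (initial_configuration T w) (halt_state T, ts) \<and>
        fst (ts ! 2) = word_on_tape (binary a))"

definition poly_time_Turing_reducible ::
    "'i counting_problem \<Rightarrow> 'j counting_problem \<Rightarrow> bool" where
  "poly_time_Turing_reducible P Q \<longleftrightarrow>
     (\<exists>T (p :: nat poly). wf_oracle_machine T \<and>
        (\<forall>x \<in> instances P.
           computes_within T Q (encode P x) (solution_count P x)
             (poly p (length (encode P x)))))"


section \<open>Encodings are unambiguous and machines are deterministic\<close>

lemma binary_inject: "binary m = binary n \<longleftrightarrow> m = n"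
proof (induction m arbitrary: n rule: binary.induct)
  case (1 m)
  show ?case
  proof (cases "m = 0 \<or> n = 0")
    case True
    then show ?thesis
      by (auto simp: binary.simps[of m] binary.simps[of n] binary.simps[of 0])
  next
    case False
    then have "binary m = binary n \<longleftrightarrow> odd m = odd n \<and> m div 2 = n div 2"
      using 1 by (simp add: binary.simps[of m] binary.simps[of n])
    also have "\<dots> \<longleftrightarrow> m = n"
      by presburger
    finally show ?thesis .
  qed
qed

lemma word_on_tape_inject: "word_on_tape v = word_on_tape w \<longleftrightarrow> v = w"
proof
  assume eq: "word_on_tape v = word_on_tape w"
  have zero: "word_on_tape u (int i) = 0 \<longleftrightarrow> length u \<le> i" for u i
    by (auto simp: word_on_tape_def)
  have "length v \<le> i \<longleftrightarrow> length w \<le> i" for i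
    using zero[of v i] zero[of w i] eq by simp
  then have len: "length v = length w"
    by (metis order_refl order_antisym)
  show "v = w"
  proof (rule nth_equalityI[OF len])
    fix i assume "i < length v"
    then show "v ! i = w ! i"
      using fun_cong[OF eq, of "int i"] len by (simp add: word_on_tape_def split: if_splits)
  qed
qed simp

lemma machine_step_deterministic:
  assumes "inj_on (encode Q) (instances Q)"
    and "machine_step T Q c c1" and "machine_step T Q c c2"
  shows "c1 = c2"
  using assms(2,3)
  by (auto elim!: machine_step.cases simp: word_on_tape_inject dest: inj_onD[OF assms(1)])

lemma replicate_True_False_inject:
  "replicate m True @ False # v = replicate n True @ False # w \<longleftrightarrow> m = n \<and> v = w"
proof (induction m arbitrary: n)
  case 0
  then show ?case by (cases n) auto
next
  case (Suc m)
  then show ?case by (cases n) auto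
qed

lemma encode_graph_append_inject:
  assumes "G \<in> input_graphs" and "H \<in> input_graphs"
    and eq: "encode_graph G @ v = encode_graph H @ w"
  shows "G = H \<and> v = w"
proof -
  obtain m n where mn: "pverts G = {..<m}" "pverts H = {..<n}"
    using assms(1,2) by (auto simp: input_graphs_def)
  interpret G: pair_graph G using assms(1) by (simp add: input_graphs_def)
  interpret H: pair_graph H using assms(2) by (simp add: input_graphs_def)
  have "m = n \<and> map (\<lambda>e. e \<in> parcs G) (List.product [0..<m] [0..<m]) @ v =
         map (\<lambda>e. e \<in> parcs H) (List.product [0..<n] [0..<n]) @ w"
    using eq unfolding encode_graph_def mn Let_def card_lessThan append_assoc append_Cons
      replicate_True_False_inject .
  then have "m = n"
    and maps: "map (\<lambda>e. e \<in> parcs G) (List.product [0..<m] [0..<m]) @ v =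
         map (\<lambda>e. e \<in> parcs H) (List.product [0..<n] [0..<n]) @ w"
    by blast+
  have "map (\<lambda>e. e \<in> parcs G) (List.product [0..<n] [0..<n]) =
        map (\<lambda>e. e \<in> parcs H) (List.product [0..<n] [0..<n]) \<and> v = w"
    using maps unfolding \<open>m = n\<close> by (subst (asm) append_eq_append_conv) simp_all
  then have arcs: "\<forall>e \<in> {..<n} \<times> {..<n}. e \<in> parcs G \<longleftrightarrow> e \<in> parcs H" and "v = w"
    by (auto simp: atLeast0LessThan)
  have sub: "parcs G \<subseteq> {..<n} \<times> {..<n}" "parcs H \<subseteq> {..<n} \<times> {..<n}"
    using G.in_arcsD1 G.in_arcsD2 H.in_arcsD1 H.in_arcsD2 mn \<open>m = n\<close> by auto
  have "parcs G = parcs H"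
    using arcs sub by blast
  then show ?thesis
    using mn \<open>m = n\<close> \<open>v = w\<close> by simp
qed

lemma enumeration:
  assumes "finite D"
  shows "distinct (enumeration D)" and "set (enumeration D) = D"
proof -
  have "\<exists>ds. distinct ds \<and> set ds = D"
    using finite_distinct_list[OF assms] by blast
  then have "distinct (enumeration D) \<and> set (enumeration D) = D"
    unfolding enumeration_def by (rule someI_ex)
  then show "distinct (enumeration D)" and "set (enumeration D) = D" by auto
qed

lemma encode_lists_inject:
  assumes "finite D" and "L \<in> {..<n} \<rightarrow>\<^sub>E Pow D" and "K \<in> {..<n} \<rightarrow>\<^sub>E Pow D"
    and eq: "encode_lists D n L = encode_lists D n K"
  shows "L = K"
proof -
  have "map (\<lambda>v. map (\<lambda>d. d \<in> L v) (enumeration D)) [0..<n] =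
        map (\<lambda>v. map (\<lambda>d. d \<in> K v) (enumeration D)) [0..<n]"
    by (rule concat_injective[OF eq[unfolded encode_lists_def]]) (auto simp: set_zip)
  then have mem: "\<forall>v<n. \<forall>d\<in>D. d \<in> L v \<longleftrightarrow> d \<in> K v"
    using enumeration(2)[OF assms(1)] by (auto simp: atLeast0LessThan)
  show ?thesis
  proof (rule PiE_ext[OF assms(2,3)])
    fix v assume "v \<in> {..<n}"
    then show "L v = K v"
      using mem assms(2,3) by (auto dest!: PiE_mem)
  qed
qed

lemma inj_on_encode_C_M_partitions:
  "inj_on (encode (C_M_partitions D C M)) (instances (C_M_partitions D C M))"
  using encode_graph_append_inject[of _ _ "[]" "[]"]
  by (auto simp: C_M_partitions_def intro!: inj_onI)

lemma inj_on_encode_List_M_partitions: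
  assumes "finite D"
  shows "inj_on (encode (List_M_partitions D M)) (instances (List_M_partitions D M))"
proof (rule inj_onI, clarsimp simp: List_M_partitions_def)
  fix G L H K
  assume G: "G \<in> input_graphs" and H: "H \<in> input_graphs"
    and L: "L \<in> pverts G \<rightarrow>\<^sub>E Pow D" and K: "K \<in> pverts H \<rightarrow>\<^sub>E Pow D"
    and eq: "encode_graph G @ encode_lists D (card (pverts G)) L =
             encode_graph H @ encode_lists D (card (pverts H)) K"
  obtain n where n: "pverts G = {..<n}"
    using G by (auto simp: input_graphs_def)
  have "G = H" and "encode_lists D (card (pverts G)) L = encode_lists D (card (pverts H)) K"
    using encode_graph_append_inject[OF G H eq] by auto
  then show "G = H \<and> L = K"
    using encode_lists_inject[OF assms, of L n K] L K n by simp
qed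

end

theory Submission
  imports Defs "HOL-Library.Countable" "HOL-Library.Sublist"
begin

text \<open>
  Assign the vertices one after another and keep, for every \<open>d \<in> D\<close>, the number of vertices that
  \<open>d\<close> still has to receive.  A vertex either gets one particular part \<open>d\<close> whose requirement is still
  open, which lowers it by one, or any part whose requirement is already met, which
  changes nothing.  Every \<open>M\<close>-partition satisfying \<open>C\<close> thus follows exactly one branch of
  a search tree, and those following a given branch are the \<open>M\<close>-partitions that respect the lists
  on this branch, which the oracle counts; the answer is the sum over the leaves at which
  nothing is left to be required.  The tree is polynomially large because
  a branch contains at most \<open>\<Sum>\<^sub>d C d\<close> vertices of the first kind.
  A Turing machine traverses it depth first with the stack on a work tape.
\<close>

section \<open>The search tree\<close>

type_synonym branch = "bool list \<times> nat list"

text \<open>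
  Relative to an enumeration of \<open>D\<close>, open requirements are lists of numbers and the list of a
  vertex is its characteristic vector, in the form in which it occurs in the oracle query.
\<close>

definition free_label :: "nat list \<Rightarrow> bool list" where
  "free_label c = map (\<lambda>x. x = 0) c"

definition unit_label :: "nat \<Rightarrow> nat \<Rightarrow> bool list" where
  "unit_label k i = map (\<lambda>j. j = i) [0..<k]"

definition branches :: "nat list \<Rightarrow> branch list" where
  "branches c = (free_label c, c) #
     map (\<lambda>i. (unit_label (length c) i, c[i := c ! i - 1])) (filter (\<lambda>i. 0 < c ! i) [0..<length c])"

primrec leaf_sum :: "(bool list list \<Rightarrow> nat) \<Rightarrow> nat \<Rightarrow> nat list \<Rightarrow> bool list list \<Rightarrow> nat" where
  "leaf_sum N 0 c ls = (if set c \<subseteq> {0} then N ls else 0)"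
| "leaf_sum N (Suc r) c ls = (\<Sum>(l, c')\<leftarrow>branches c. leaf_sum N r c' (ls @ [l]))"

text \<open>\<open>B\<close> bounds the work at a leaf. An inner node takes one step from
  \<open>Descend\<close> to \<open>Branch\<close> and one from the exhausted \<open>Branch\<close>
  to \<open>Ascend\<close>; an edge takes one step down and one \<open>Ascend\<close> step to resume
  the remaining branches.\<close>

primrec search_time :: "nat \<Rightarrow> nat \<Rightarrow> nat list \<Rightarrow> nat" where
  "search_time B 0 c = B"
| "search_time B (Suc r) c = 2 + (\<Sum>(l, c')\<leftarrow>branches c. 2 + search_time B r c')"

lemma branches_length:
  "(l, c') \<in> set (branches c) \<Longrightarrow> length l = length c \<and> length c' = length c"
  by (auto simp: branches_def free_label_def unit_label_def)

lemma branches_bounded: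
  assumes "(l, c') \<in> set (branches c)" and "set c \<subseteq> {..m}"
  shows "set c' \<subseteq> {..m}"
proof -
  have "set (c[i := c ! i - 1]) \<subseteq> {..m}" if "i < length c" for i
    using that assms(2) set_update_subset_insert[of c i "c ! i - 1"] nth_mem[OF that] by fastforce
  then show ?thesis
    using assms by (auto simp: branches_def)
qed

section \<open>Polynomial bound on the traversal time\<close>

lemma power_Suc_ge:
  fixes r s k m :: nat
  assumes "m \<le> k" and "0 < s"
  shows "1 + r ^ Suc s * (k + 1) ^ s + m * (r ^ s * (k + 1) ^ (s - 1)) \<le> (r + 1) ^ Suc s * (k + 1) ^ s"
proof -
  obtain u where s: "s = Suc u" using assms(2) by (cases s) auto
  have "r ^ s + 1 \<le> (r + 1) ^ s"
  proof -
    have "r * r ^ u \<le> r * (r + 1) ^ u" by (intro mult_left_mono power_mono) auto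
    moreover have "1 \<le> (r + 1) ^ u" by simp
    moreover have "(r + 1) ^ s = r * (r + 1) ^ u + (r + 1) ^ u" and "r ^ s = r * r ^ u"
      by (simp_all add: s)
    ultimately show ?thesis by linarith
  qed
  moreover have "r * r ^ s \<le> r * (r + 1) ^ s"
    by (intro mult_left_mono power_mono) auto
  moreover have "(r + 1) ^ Suc s = r * (r + 1) ^ s + (r + 1) ^ s" and "r ^ Suc s = r * r ^ s"
    by simp_all
  \<comment> \<open>After multiplication by \<open>(k + 1) ^ s\<close>, the gained
    \<open>r ^ s\<close> pays for the \<open>m\<close> unit branches and the \<open>1\<close> for
    the node itself. The gain of \<open>1\<close> comes from \<open>0 < s\<close>.\<close>
  ultimately have "r ^ Suc s + (r ^ s + 1) \<le> (r + 1) ^ Suc s"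
    by linarith
  then have "(r ^ Suc s + (r ^ s + 1)) * (k + 1) ^ s \<le> (r + 1) ^ Suc s * (k + 1) ^ s"
    by (rule mult_right_mono) simp
  moreover have "m * (r ^ s * (k + 1) ^ (s - 1)) \<le> r ^ s * (k + 1) ^ s"
  proof -
    have "m * (r ^ s * (k + 1) ^ u) \<le> (k + 1) * (r ^ s * (k + 1) ^ u)"
      using assms(1) by (intro mult_right_mono) auto
    also have "\<dots> = r ^ s * (k + 1) ^ s" by (simp only: s power_Suc mult.left_commute)
    finally show ?thesis by (simp add: s)
  qed
  moreover have "1 \<le> (k + 1) ^ s" by simp
  ultimately show ?thesis
    by (simp only: distrib_right)
qed

text \<open>Polynomial in \<open>r\<close> for fixed \<open>k\<close> and \<open>sum_list c\<close>:
  the free branch keeps the exponents, and each of the at most \<open>k\<close> unit branches lowers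
  them by one. The factor \<open>B + 2 * k + 4\<close> covers a leaf as well as the steps at one
  node and all its edges.\<close>

lemma search_time_le:
  assumes "length c = k"
  shows "search_time B r c \<le> (B + 2 * k + 4) * ((r + 1) ^ Suc (sum_list c) * (k + 1) ^ sum_list c)"
  using assms
proof (induction r arbitrary: c)
  case 0
  have "1 \<le> (k + 1) ^ sum_list c" by simp
  then have "B * 1 \<le> (B + 2 * k + 4) * (k + 1) ^ sum_list c"
    by (intro mult_le_mono) auto
  then show ?case by simp
next
  case (Suc r)
  define s where "s = sum_list c"
  define b where "b = B + 2 * k + 4"
  define js where "js = filter (\<lambda>i. 0 < c ! i) [0..<k]"
  have "length js \<le> k"
    unfolding js_def by (metis diff_zero length_filter_le length_upt)
  have dec: "search_time B r (c[i := c ! i - 1]) \<le> b * (r' ^ s * (k + 1) ^ (s - 1))"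
    if "i \<in> set js" and "r' = r + 1" for i r'
  proof -
    have i: "i < length c" "0 < c ! i" using that Suc.prems by (auto simp: js_def)
    then have "c ! i \<le> s" unfolding s_def by (intro member_le_sum_list) auto
    then have "Suc (sum_list (c[i := c ! i - 1])) = s"
      using i by (simp add: sum_list_update s_def)
    then show ?thesis
      using Suc.IH[of "c[i := c ! i - 1]"] Suc.prems that unfolding b_def by (metis diff_Suc_1 length_list_update)
  qed
  have "(\<Sum>i\<leftarrow>js. 2 + search_time B r (c[i := c ! i - 1]))
      \<le> (\<Sum>i\<leftarrow>js. 2 + b * ((r + 1) ^ s * (k + 1) ^ (s - 1)))"
    using dec by (intro sum_list_mono) auto
  also have "\<dots> = length js * (2 + b * ((r + 1) ^ s * (k + 1) ^ (s - 1)))"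
    by (simp add: sum_list_triv)
  finally have "search_time B (Suc r) c \<le>
      2 + (2 + b * ((r + 1) ^ Suc s * (k + 1) ^ s)) +
      length js * (2 + b * ((r + 1) ^ s * (k + 1) ^ (s - 1)))"
    using Suc.IH[of c] Suc.prems
    by (simp add: branches_def js_def s_def b_def comp_def)
  also have "\<dots> \<le> b * (1 + (r + 1) ^ Suc s * (k + 1) ^ s +
      length js * ((r + 1) ^ s * (k + 1) ^ (s - 1)))"
    using \<open>length js \<le> k\<close> by (simp add: algebra_simps b_def)
  also have "\<dots> \<le> b * ((r + 1 + 1) ^ Suc s * (k + 1) ^ s)"
  proof (cases "s = 0")
    case True
    \<comment> \<open>Without open requirements there are no unit branches;
      \<open>power_Suc_ge\<close> covers positive \<open>s\<close> only.\<close>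
    then have "js = []"
      using Suc.prems nth_mem[of _ c] by (auto simp: js_def s_def filter_empty_conv)
    then show ?thesis using True by simp
  next
    case False
    then show ?thesis
      using power_Suc_ge[OF \<open>length js \<le> k\<close>, of s "r + 1"] by (intro mult_left_mono) auto
  qed
  finally show ?case by (simp add: b_def s_def)
qed


section \<open>Tapes holding finite words\<close>

text \<open>Extends \<open>word_on_tape\<close> from bits to arbitrary symbols, as the stack tape
  demands.\<close>

definition word :: "nat list \<Rightarrow> int \<Rightarrow> nat" where
  "word xs i = (if 0 \<le> i \<and> i < int (length xs) then xs ! nat i else 0)"

definition bit_sym :: "bool \<Rightarrow> nat" where
  "bit_sym b = (if b then 2 else 1)"

lemma bit_simps [simp]: "bit_sym b \<noteq> 0" "0 < bit_sym b" "bit_sym b = 2 \<longleftrightarrow> b" "bit_sym b = Suc 0 \<longleftrightarrow> \<not> b"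
  by (auto simp: bit_sym_def)

lemma word_on_tape_eq: "word_on_tape w = word (map bit_sym w)"
  by (auto simp: word_on_tape_def word_def bit_sym_def fun_eq_iff nat_less_iff)

lemma word_Nil [simp]: "word [] = (\<lambda>_. 0)"
  by (auto simp: word_def)

lemma word_minus_one [simp]: "word xs (- 1) = 0"
  by (simp add: word_def)

lemma word_nth [simp]: "word xs (int i) = (if i < length xs then xs ! i else 0)"
  by (simp add: word_def)

lemma word_snoc [simp]: "i = length xs \<Longrightarrow> (word xs)(int i := s) = word (xs @ [s])"
  by (auto simp: word_def fun_eq_iff nth_append)

lemma word_update_idem [simp]: "word xs i = s \<Longrightarrow> (word xs)(i := s) = word xs"
  by auto

lemma word_update: "i < length xs \<Longrightarrow> (word xs)(int i := s) = word (xs[i := s])"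
  by (auto simp: word_def fun_eq_iff nth_list_update)

lemma word_snoc_update [simp]: "i = length xs \<Longrightarrow> (word (xs @ [y]))(int i := s) = word (xs @ [s])"
  by (simp add: word_update)

lemma word_take_Suc: "(word (take (Suc i) xs))(int i := 0) = word (take i xs)"
  by (auto simp: word_def fun_eq_iff)

text \<open>Trailing blanks are invisible, so overwriting the topmost stack cell with a blank pops
  it.\<close>

lemma word_snoc_blank [simp]: "word (xs @ [0]) = word xs"
  by (auto simp: word_def fun_eq_iff nth_append)


lemma blank_update [simp]: "(\<lambda>_. 0)(i := 0) = (\<lambda>_. 0)"
  by auto


lemma length_binary_le_iff: "length (binary x) \<le> m \<longleftrightarrow> x < 2 ^ m"
proof (induction m arbitrary: x)
  case 0
  show ?case by (subst binary.simps) simp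
next
  case (Suc m)
  show ?case
    using Suc.IH[of "x div 2"] by (subst binary.simps) (auto simp: less_mult_imp_div_less div_less_iff_less_mult)
qed

text \<open>Hence a bound on the length of the final total also bounds all partial sums.\<close>

lemma length_binary_mono: "x \<le> y \<Longrightarrow> length (binary x) \<le> length (binary y)"
  using length_binary_le_iff[of y "length (binary y)"] by (simp add: length_binary_le_iff)


section \<open>The machine\<close>

text \<open>The finite control remembers open requirements, unexplored branches, the rest of a label
  being written, or a carry. For fixed \<open>c0\<close> finitely many values suffice, collected in
  \<open>controls\<close>; countability lets \<open>to_nat\<close> number them.\<close>

datatype control =
    Descend "nat list" | Branch "branch list" | Ascend
  | Rewind | Copy_Input | Fetch | Emit "bool list" | Return | Seek | Query
  | Add bool | Clear | Halt

instance control :: countable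
  by countable_datatype

text \<open>A stack cell records the list chosen for its vertex and the branches not yet explored there.\<close>

definition symbol :: "bool list \<times> branch list \<Rightarrow> nat" where
  "symbol x = to_nat x + 3"

definition unsymbol :: "nat \<Rightarrow> bool list \<times> branch list" where
  "unsymbol s = from_nat (s - 3)"

lemma unsymbol_symbol [simp]: "unsymbol (symbol x) = x"
  by (simp add: symbol_def unsymbol_def)

lemma symbol_ge [simp]: "\<not> symbol x < 3"
  by (simp add: symbol_def)

text \<open>
  During the traversal the input head and the stack head are both at the depth of the current node.
  As the input starts with \<open>n\<close> in unary, a leaf is recognised by reading a symbol other than \<open>2\<close>, and
  a stack head to the left of cell \<open>0\<close> reads a blank, which ends the traversal.
  At an accepting leaf the states from \<^const>\<open>Rewind\<close> to \<^const>\<open>Seek\<close> write the query and restore both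
  heads; \<^const>\<open>Add\<close> adds the answer to the output tape and \<^const>\<open>Clear\<close> blanks the oracle tape.
\<close>

fun control_step :: "control \<Rightarrow> nat \<Rightarrow> nat \<Rightarrow> nat \<Rightarrow> nat \<Rightarrow> control \<times> (nat \<times> direction) list" where
  "control_step (Descend x) a b c d =
     (if a = 2 then (Branch (branches x), [(a, Stay), (b, Stay), (c, Stay), (d, Stay)])
      else (if set x \<subseteq> {0} then Rewind else Ascend,
            [(a, Move_Left), (b, Stay), (c, Stay), (d, Move_Left)]))"
| "control_step (Branch []) a b c d =
     (Ascend, [(a, Move_Left), (b, Stay), (c, Stay), (0, Move_Left)])"
| "control_step (Branch ((l, x) # xs)) a b c d =
     (Descend x, [(a, Move_Right), (b, Stay), (c, Stay), (symbol (l, xs), Move_Right)])"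
| "control_step Ascend a b c d =
     (if d < 3 then Halt else Branch (snd (unsymbol d)),
      [(a, Stay), (b, Stay), (c, Stay), (d, Stay)])"
| "control_step Rewind a b c d =
     (if a = 0 then (Copy_Input, [(a, Move_Right), (b, Stay), (c, Stay), (d, Move_Right)])
      else (Rewind, [(a, Move_Left), (b, Stay), (c, Stay), (d, Move_Left)]))"
| "control_step Copy_Input a b c d =
     (if a = 0 then (Fetch, [(a, Move_Left), (b, Stay), (c, Stay), (d, Stay)])
      else (Copy_Input, [(a, Move_Right), (a, Move_Right), (c, Stay), (d, Stay)]))"
| "control_step Fetch a b c d =
     (if d < 3 then Return else Emit (fst (unsymbol d)),
      [(a, Stay), (b, Stay), (c, Stay), (d, Stay)])"
| "control_step (Emit []) a b c d =
     (Fetch, [(a, Stay), (b, Stay), (c, Stay), (d, Move_Right)])"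
| "control_step (Emit (e # es)) a b c d =
     (Emit es, [(a, Stay), (bit_sym e, Move_Right), (c, Stay), (d, Stay)])"
| "control_step Return a b c d =
     (if a = 0 then (Seek, [(a, Move_Right), (b, Stay), (c, Stay), (d, Stay)])
      else (Return, [(a, Move_Left), (b, Stay), (c, Stay), (d, Stay)]))"
| "control_step Seek a b c d =
     (if a = 2 then (Seek, [(a, Move_Right), (b, Stay), (c, Stay), (d, Stay)])
      else (Query, [(a, Stay), (b, Stay), (c, Stay), (d, Stay)]))"
| "control_step (Add e) a b c d =
     (if b = 0 \<and> c = 0 \<and> \<not> e then (Clear, [(a, Stay), (b, Move_Left), (c, Move_Left), (d, Stay)])
      else (Add (b = 2 \<and> c = 2 \<or> e \<and> (b = 2 \<or> c = 2)),
            [(a, Stay), (b, Move_Right), (bit_sym ((b = 2) \<noteq> ((c = 2) \<noteq> e)), Move_Right), (d, Stay)]))"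
| "control_step Clear a b c d =
     (if c = 0 then (Ascend, [(a, Move_Left), (0, Move_Right), (c, Move_Right), (d, Move_Left)])
      else (Clear, [(a, Stay), (0, Move_Left), (c, Move_Left), (d, Stay)]))"
| "control_step Query a b c d = (Query, [(a, Stay), (b, Stay), (c, Stay), (d, Stay)])"
| "control_step Halt a b c d = (Halt, [(a, Stay), (b, Stay), (c, Stay), (d, Stay)])"

section \<open>Finiteness and closure of states and alphabet\<close>

definition counters :: "nat list \<Rightarrow> nat list set" where
  "counters c0 = {c. length c = length c0 \<and> set c \<subseteq> {..sum_list c0}}"

definition branch_lists :: "nat list \<Rightarrow> branch list set" where
  "branch_lists c0 = insert [] (\<Union>c\<in>counters c0. {xs. suffix xs (branches c)})"

text \<open>A length bound, unlike a fixed length, is inherited by the tails that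
  \<open>Emit\<close> passes through.\<close>

definition labels :: "nat \<Rightarrow> bool list set" where
  "labels k = {l. length l \<le> k}"

definition stack_symbols :: "nat list \<Rightarrow> (bool list \<times> branch list) set" where
  "stack_symbols c0 = labels (length c0) \<times> branch_lists c0"

definition controls :: "nat list \<Rightarrow> control set" where
  "controls c0 = Descend ` counters c0 \<union> Branch ` branch_lists c0 \<union> Emit ` labels (length c0)
     \<union> range Add \<union> {Ascend, Rewind, Copy_Input, Fetch, Return, Seek, Query, Clear, Halt}"

definition search_machine :: "nat list \<Rightarrow> oracle_machine" where
  "search_machine c0 =
    \<lparr> tape_number = 4,
      alphabet = {0, 1, 2} \<union> symbol ` stack_symbols c0,
      states = to_nat ` controls c0,
      start_state = to_nat (Descend c0),
      halt_state = to_nat Halt,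
      query_state = to_nat Query,
      answer_state = to_nat (Add False),
      transition = (\<lambda>q ss.
        case control_step (from_nat q) (ss ! 0) (ss ! 1) (ss ! 2) (ss ! 3) of
          (q', acts) \<Rightarrow> (to_nat q', acts)) \<rparr>"

lemma finite_counters: "finite (counters c0)"
  using finite_lists_length_eq[of "{..sum_list c0}" "length c0"]
  by (simp add: counters_def conj_commute)

lemma finite_branch_lists: "finite (branch_lists c0)"
  using finite_counters by (auto simp: branch_lists_def simp flip: in_set_suffixes)

lemma finite_labels: "finite (labels k)"
  using finite_lists_length_le[of "UNIV :: bool set" k] by (simp add: labels_def)

lemma finite_controls: "finite (controls c0)"
  using finite_counters finite_branch_lists finite_labels by (simp add: controls_def)

lemma start_counters: "c0 \<in> counters c0"
  by (auto simp: counters_def member_le_sum_list)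

lemma branches_branch_lists: "c \<in> counters c0 \<Longrightarrow> branches c \<in> branch_lists c0"
  by (auto simp: branch_lists_def)

lemma Cons_branch_lists:
  assumes "(l, c) # xs \<in> branch_lists c0"
  shows "l \<in> labels (length c0)" and "c \<in> counters c0" and "xs \<in> branch_lists c0"
proof -
  obtain c' where c': "c' \<in> counters c0" and suf: "suffix ((l, c) # xs) (branches c')"
    using assms by (auto simp: branch_lists_def)
  have "(l, c) \<in> set (branches c')"
    using set_mono_suffix[OF suf] by auto
  then show "l \<in> labels (length c0)" and "c \<in> counters c0"
    using c' branches_length branches_bounded by (fastforce simp: counters_def labels_def)+
  show "xs \<in> branch_lists c0"
    using c' suffix_ConsD[OF suf] by (auto simp: branch_lists_def)
qed

text \<open>A scanned symbol of at least \<open>3\<close> encodes a stack entry, so what is decoded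
  from it is admissible; tails of admissible labels and branch lists stay admissible.\<close>

lemma control_step_closed:
  assumes "q \<in> controls c0" and "{a, b, c, d} \<subseteq> A"
    and A: "A = {0, 1, 2} \<union> symbol ` stack_symbols c0"
    and "control_step q a b c d = (q', acts)"
  shows "q' \<in> controls c0 \<and> length acts = 4 \<and> fst ` set acts \<subseteq> A"
proof -
  have d: "fst (unsymbol d) \<in> labels (length c0)" "snd (unsymbol d) \<in> branch_lists c0"
    if "\<not> d < 3"
    using that assms(2) unfolding A by (auto simp: stack_symbols_def)
  have bits: "0 \<in> A" "1 \<in> A" "2 \<in> A" "bit_sym e \<in> A" and read: "a \<in> A" "b \<in> A" "c \<in> A" "d \<in> A" for e
    using assms(2) unfolding A by (auto simp: bit_sym_def)
  have sym: "symbol (l, xs) \<in> A" if "(l, x) # xs \<in> branch_lists c0" for l x xs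
    using Cons_branch_lists[OF that] unfolding A by (simp add: stack_symbols_def)
  have inner: "Descend x \<in> controls c0 \<longleftrightarrow> x \<in> counters c0"
    "Branch xs \<in> controls c0 \<longleftrightarrow> xs \<in> branch_lists c0"
    "Emit l \<in> controls c0 \<longleftrightarrow> l \<in> labels (length c0)" for x xs l
    by (auto simp: controls_def)
  have fixed: "{Ascend, Rewind, Copy_Input, Fetch, Return, Seek, Query, Clear, Halt} \<subseteq> controls c0"
    "Add e \<in> controls c0" for e
    by (auto simp: controls_def)
  have tail: "es \<in> labels k" if "e # es \<in> labels k" for e es k
    using that by (simp add: labels_def)
  note step = assms(1,4)
  show ?thesis
  \<comment> \<open>The cases singled out are those whose successor state may carry data.\<close>
  proof (cases rule: control_step.cases[of "(q, a, b, c, d)"])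
    case (1 x)
    then show ?thesis
      using step read fixed inner(1,2) branches_branch_lists[of x c0] by (auto split: if_splits)
  next
    case (3 l x xs)
    then show ?thesis
      using step read inner(1,2) sym Cons_branch_lists[of l x xs c0] by auto
  next
    case 4
    then show ?thesis
      using step read fixed(1) d inner(2) by (auto split: if_splits)
  next
    case 7
    then show ?thesis
      using step read fixed(1) d inner(3) by (auto split: if_splits)
  next
    case (9 e es)
    then show ?thesis
      using step read bits inner(3) tail by auto
  next
    case (12 e)
    then show ?thesis
      using step read bits fixed by (auto split: if_splits)
  qed (use step read bits fixed(1) in \<open>auto split: if_splits\<close>)
qed

lemma wf_search_machine: "wf_oracle_machine (search_machine c0)"
proof -
  let ?A = "{0, 1, 2} \<union> symbol ` stack_symbols c0"
  have "case transition (search_machine c0) q ss of (q', acts) \<Rightarrow>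
      q' \<in> to_nat ` controls c0 \<and> length acts = 4 \<and> fst ` set acts \<subseteq> ?A"
    if q: "q \<in> to_nat ` controls c0" and ss: "length ss = 4" "set ss \<subseteq> ?A" for q ss
  proof -
    obtain p where p: "p \<in> controls c0" "q = to_nat p" using q by auto
    obtain p' acts where step: "control_step p (ss ! 0) (ss ! 1) (ss ! 2) (ss ! 3) = (p', acts)"
      by fastforce
    have "{ss ! 0, ss ! 1, ss ! 2, ss ! 3} \<subseteq> ?A"
      using ss by (auto simp: subset_iff)
    from control_step_closed[OF p(1) this refl step] show ?thesis
      by (simp add: search_machine_def p step del: One_nat_def)
  qed
  moreover have "finite (stack_symbols c0)"
    by (simp add: stack_symbols_def finite_labels finite_branch_lists)
  ultimately show ?thesis
    using start_counters[of c0]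
    by (auto simp: wf_oracle_machine_def search_machine_def finite_controls)
       (auto simp: controls_def)
qed


section \<open>Runs of the machine\<close>

definition reach ::
    "oracle_machine \<Rightarrow> 'i counting_problem \<Rightarrow> nat \<Rightarrow> configuration \<Rightarrow> configuration \<Rightarrow> bool" where
  "reach T Q b x y \<longleftrightarrow> (\<exists>t\<le>b. (machine_step T Q ^^ t) x y)"

lemma reach_refl: "reach T Q b x x"
  unfolding reach_def by (rule exI[of _ 0]) simp

lemma reach_trans: "reach T Q a x y \<Longrightarrow> reach T Q b y z \<Longrightarrow> reach T Q (a + b) x z"
  unfolding reach_def by (elim exE conjE) (rule exI, rule conjI, erule (1) add_mono, erule (1) relpowp_trans)

lemma reach_mono: "reach T Q a x y \<Longrightarrow> a \<le> b \<Longrightarrow> reach T Q b x y"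
  unfolding reach_def using le_trans by blast

lemma reach_step: "machine_step T Q x y \<Longrightarrow> reach T Q 1 x y"
  unfolding reach_def by (rule exI[of _ 1]) (simp add: OO_def)

text \<open>Abstracts from graphs: the input has a unary prefix, and appending \<open>n\<close>
  labels of the right length to it gives an oracle query answered by \<open>N\<close>. The number
  \<open>m\<close> serves as a bound on the binary length of the total.\<close>

locale search =
  fixes c0 :: "nat list" and Q :: "'i counting_problem" and w rest :: "bool list"
    and n m :: nat and N :: "bool list list \<Rightarrow> nat"
  assumes input_word: "w = replicate n True @ False # rest"
    and queries: "\<And>ls. length ls = n \<Longrightarrow> \<forall>l\<in>set ls. length l = length c0 \<Longrightarrow>
      \<exists>y\<in>instances Q. encode Q y = w @ concat ls \<and> solution_count Q y = N ls"
begin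

abbreviation run :: "nat \<Rightarrow> control \<Rightarrow> tape list \<Rightarrow> control \<Rightarrow> tape list \<Rightarrow> bool" where
  "run b q ts q' ts' \<equiv> reach (search_machine c0) Q b (to_nat q, ts) (to_nat q', ts')"

abbreviation input_tape :: "int \<Rightarrow> nat" where
  "input_tape \<equiv> word (map bit_sym w)"

text \<open>Symbolic execution: \<open>control_step\<close> is evaluated on the four scanned
  symbols, leaving a run from the updated tapes.\<close>

lemma run_step:
  assumes "q \<noteq> Halt" and "q \<noteq> Query"
    and "control_step q (f0 h0) (f1 h1) (f2 h2) (f3 h3) = (q1, acts)"
    and "run b q1 (map2 act_on_tape acts [(f0, h0), (f1, h1), (f2, h2), (f3, h3)]) q' ts'"
  shows "run (Suc b) q [(f0, h0), (f1, h1), (f2, h2), (f3, h3)] q' ts'"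
proof -
  let ?ts = "[(f0, h0), (f1, h1), (f2, h2), (f3, h3)]"
  have "machine_step (search_machine c0) Q (to_nat q, ?ts) (to_nat q1, map2 act_on_tape acts ?ts)"
    by (rule machine_step.ordinary) (use assms in \<open>auto simp: search_machine_def\<close>)
  from reach_trans[OF reach_step[OF this] assms(4)] show ?thesis by simp
qed

section \<open>The phases of evaluating a leaf\<close>

lemma rewind:
  "j \<le> length w \<Longrightarrow>
   run (Suc j) Rewind [(input_tape, int j - 1), (f1, h1), (f2, h2), (f3, int j - 1)]
     Copy_Input [(input_tape, 0), (f1, h1), (f2, h2), (f3, 0)]"
proof (induction j)
  case 0
  \<comment> \<open>Bits are never blank, so the loop stops at cell \<open>-1\<close>, and its last
    step puts both heads on cell \<open>0\<close>.\<close>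
  show ?case by (rule run_step) (auto simp: reach_refl)
next
  case (Suc j)
  show ?case by (rule run_step) (use Suc in auto)
qed

text \<open>\<open>u\<close> is already copied and \<open>v\<close> is pending. The last step reads
  the blank behind the input and moves back onto its last letter, where \<open>return\<close>
  starts.\<close>

lemma copy_input:
  "w = u @ v \<Longrightarrow>
   run (Suc (length v)) Copy_Input
     [(input_tape, int (length u)), (word (map bit_sym u), int (length u)), (f2, h2), (f3, h3)]
     Fetch [(input_tape, int (length w) - 1), (input_tape, int (length w)), (f2, h2), (f3, h3)]"
proof (induction v arbitrary: u)
  case Nil
  show ?case by (rule run_step) (use Nil in \<open>auto simp: reach_refl\<close>)
next
  case (Cons e v)
  show ?case
    by (rule run_step) (use Cons.IH[of "u @ [e]"] Cons.prems in \<open>auto simp: nth_append add.commute\<close>)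
qed

lemma emit:
  "run (Suc (length es)) (Emit es)
     [(f0, h0), (word (map bit_sym u), int (length u)), (f2, h2), (f3, h3)]
     Fetch [(f0, h0), (word (map bit_sym (u @ es)), int (length (u @ es))), (f2, h2), (f3, h3 + 1)]"
proof (induction es arbitrary: u)
  case Nil
  show ?case by (rule run_step) (auto simp: reach_refl)
next
  case (Cons e es)
  show ?case
    by (rule run_step) (use Cons.IH[of "u @ [e]"] in \<open>auto simp: add.commute\<close>)
qed

text \<open>\<open>S\<close> is already emitted and \<open>S'\<close> is pending. An entry takes one
  step of \<open>Fetch\<close> and \<open>length l + 1\<close> steps of \<open>Emit\<close>; the
  blank behind the stack ends the loop.\<close>

lemma fetch:
  "run (Suc (\<Sum>(l, xs)\<leftarrow>S'. length l + 2)) Fetch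
     [(f0, h0), (word (map bit_sym u), int (length u)), (f2, h2),
      (word (map symbol (S @ S')), int (length S))]
     Return
     [(f0, h0), (word (map bit_sym (u @ concat (map fst S'))), int (length (u @ concat (map fst S')))),
      (f2, h2), (word (map symbol (S @ S')), int (length (S @ S')))]"
proof (induction S' arbitrary: u S)
  case Nil
  show ?case by (rule run_step) (auto simp: reach_refl)
next
  case (Cons x S')
  obtain l xs where x: "x = (l, xs)" by fastforce
  let ?t = "word (map symbol (S @ x # S'))"
  have "run (Suc (Suc (length l))) Fetch
     [(f0, h0), (word (map bit_sym u), int (length u)), (f2, h2), (?t, int (length S))]
     Fetch [(f0, h0), (word (map bit_sym (u @ l)), int (length (u @ l))), (f2, h2),
       (?t, int (length (S @ [x])))]"
    by (rule run_step) (use emit[of l f0 h0 u f2 h2 ?t "int (length S)"] in \<open>auto simp: nth_append x ac_simps\<close>)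
  moreover have "run (Suc (\<Sum>(l, xs)\<leftarrow>S'. length l + 2)) Fetch
     [(f0, h0), (word (map bit_sym (u @ l)), int (length (u @ l))), (f2, h2),
       (?t, int (length (S @ [x])))]
     Return
     [(f0, h0), (word (map bit_sym (u @ concat (map fst (x # S')))),
       int (length (u @ concat (map fst (x # S'))))), (f2, h2), (?t, int (length (S @ x # S')))]"
    using Cons.IH[of "u @ l" "S @ [x]"] by (simp add: x add.assoc)
  ultimately have "run (Suc (Suc (length l)) + Suc (\<Sum>(l, xs)\<leftarrow>S'. length l + 2)) Fetch
     [(f0, h0), (word (map bit_sym u), int (length u)), (f2, h2), (?t, int (length S))]
     Return
     [(f0, h0), (word (map bit_sym (u @ concat (map fst (x # S')))),
       int (length (u @ concat (map fst (x # S'))))), (f2, h2), (?t, int (length (S @ x # S')))]"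
    by (rule reach_trans)
  then show ?case
    by (rule reach_mono) (simp add: x)
qed

lemma return:
  "j \<le> length w \<Longrightarrow>
   run (Suc j) Return [(input_tape, int j - 1), (f1, h1), (f2, h2), (f3, h3)]
     Seek [(input_tape, 0), (f1, h1), (f2, h2), (f3, h3)]"
proof (induction j)
  case 0
  show ?case by (rule run_step) (auto simp: reach_refl)
next
  case (Suc j)
  show ?case by (rule run_step) (use Suc in auto)
qed

lemma read_input: "i \<le> n \<Longrightarrow> input_tape (int i) = bit_sym (i < n)"
  by (auto simp: input_word nth_append)

text \<open>The unary prefix leads the input head back to cell \<open>n\<close>, where
  \<open>fetch\<close> leaves the stack head at a leaf.\<close>

lemma seek:
  "i + j = n \<Longrightarrow>
   run (Suc j) Seek [(input_tape, int i), (f1, h1), (f2, h2), (f3, h3)]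
     Query [(input_tape, int n), (f1, h1), (f2, h2), (f3, h3)]"
proof (induction j arbitrary: i)
  case 0
  show ?case by (rule run_step) (use 0 in \<open>auto simp: reach_refl read_input simp del: word_nth\<close>)
next
  case (Suc j)
  show ?case
    by (rule run_step)
      (use Suc.IH[of "Suc i"] Suc.prems in \<open>auto simp: read_input add.commute simp del: word_nth\<close>)
qed

lemma query:
  assumes "length ls = n" and "\<forall>l\<in>set ls. length l = length c0"
  shows "run 1 Query [t0, (word (map bit_sym (w @ concat ls)), h1), t2, t3]
    (Add False) [t0, (word (map bit_sym (binary (N ls))), 0), t2, t3]"
proof -
  obtain y where y: "y \<in> instances Q" "encode Q y = w @ concat ls" "solution_count Q y = N ls"
    using queries[OF assms] by blast
  show ?thesis
    using machine_step.query[of "to_nat Query" "search_machine c0" y Q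
        "[t0, (word (map bit_sym (w @ concat ls)), h1), t2, t3]"] y
    by (intro reach_step) (simp add: search_machine_def word_on_tape_eq)
qed

text \<open>\<open>v\<close> holds the digits of the sum written so far; \<open>a\<close> and \<open>b\<close> are what remains to be added.\<close>

lemma add:
  assumes "drop (length v) B = binary b"
  shows "run (Suc (length (binary (a + b + of_bool e)))) (Add e)
     [(f0, h0), (word (map bit_sym B), int (length v)),
      (word (map bit_sym (v @ binary a)), int (length v)), (f3, h3)]
     Clear
     [(f0, h0), (word (map bit_sym B), int (length (v @ binary (a + b + of_bool e))) - 1),
      (word (map bit_sym (v @ binary (a + b + of_bool e))),
         int (length (v @ binary (a + b + of_bool e))) - 1), (f3, h3)]"
  using assms
proof (induction "a + b + of_bool e" arbitrary: a b e v rule: less_induct)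
  case less
  have read_B: "word (map bit_sym B) (int (length v)) = (if b = 0 then 0 else bit_sym (odd b))"
  proof (cases "b = 0")
    case False
    then have "drop (length v) B = odd b # binary (b div 2)"
      using less.prems by (simp add: binary.simps[of b])
    then show ?thesis using False
      by (simp add: nth_via_drop) (metis drop_all list.discI not_le)
  qed (use less.prems in \<open>simp add: binary.simps\<close>)
  have drop_B: "drop (Suc (length v)) B = binary (b div 2)"
  proof (cases "b = 0")
    case False
    have "drop (Suc (length v)) B = tl (drop (length v) B)"
      by (simp add: drop_Suc tl_drop)
    then show ?thesis
      using False less.prems by (simp add: binary.simps[of b])
  qed (use less.prems in \<open>simp add: binary.simps\<close>)
  have read_v: "word (map bit_sym (v @ binary a)) (int (length v)) = (if a = 0 then 0 else bit_sym (odd a))"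
    by (simp add: binary.simps[of a] nth_append)
  \<comment> \<open>Writing a digit replaces the low digit of \<open>a\<close>, or extends the word
    if \<open>a = 0\<close>; \<open>a div 2\<close> remains to its right.\<close>
  have update_v: "(word (map bit_sym (v @ binary a)))(int (length v) := s) =
      word (map bit_sym v @ s # map bit_sym (binary (a div 2)))" for s
    by (simp add: binary.simps[of a] binary.simps[of 0] word_update list_update_append)
  show ?case
  proof (cases "a = 0 \<and> b = 0 \<and> \<not> e")
    case True
    have "word (map bit_sym B) (int (length v)) = 0" and "word (map bit_sym v) (int (length v)) = 0"
      unfolding read_B using True by simp_all
    with True show ?thesis
      by (intro run_step) (auto simp: reach_refl binary.simps[of 0] simp del: word_nth)
  next
    case False
    \<comment> \<open>The new carry is the majority of both digits and the old carry; the digit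
      \<open>d\<close> is their parity.\<close>
    define e' where "e' \<longleftrightarrow> odd b \<and> odd a \<or> e \<and> (odd b \<or> odd a)"
    define d where "d \<longleftrightarrow> (odd b \<noteq> (odd a \<noteq> e))"
    let ?v = "v @ [d]"
    have half: "(a + b + of_bool e) div 2 = a div 2 + b div 2 + of_bool e'"
      and odd: "odd (a + b + of_bool e) = d"
      unfolding e'_def d_def by (cases e; simp; presburger)+
    have sum: "binary (a + b + of_bool e) = d # binary (a div 2 + b div 2 + of_bool e')"
      using False by (subst binary.simps) (simp only: half odd, auto)
    \<comment> \<open>The sum is positive in this case, so halving decreases the induction
      measure.\<close>
    have smaller: "a div 2 + b div 2 + of_bool e' < a + b + of_bool e"
      unfolding half[symmetric] using False by auto
    have IH: "run (Suc (length (binary (a div 2 + b div 2 + of_bool e')))) (Add e')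
      [(f0, h0), (word (map bit_sym B), int (length ?v)),
       (word (map bit_sym (?v @ binary (a div 2))), int (length ?v)), (f3, h3)]
      Clear
      [(f0, h0), (word (map bit_sym B), int (length (v @ binary (a + b + of_bool e))) - 1),
       (word (map bit_sym (v @ binary (a + b + of_bool e))),
          int (length (v @ binary (a + b + of_bool e))) - 1), (f3, h3)]"
      using less.hyps[OF smaller, of ?v] drop_B unfolding sum by simp
    have step: "control_step (Add e) (f0 h0) (word (map bit_sym B) (int (length v)))
        (word (map bit_sym (v @ binary a)) (int (length v))) (f3 h3) =
      (Add e', [(f0 h0, Stay), (word (map bit_sym B) (int (length v)), Move_Right),
        (bit_sym d, Move_Right), (f3 h3, Stay)])"
      using False unfolding read_B read_v e'_def d_def by (cases e; cases "odd a"; cases "odd b") (auto simp: odd_pos)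
    have "run (Suc (Suc (length (binary (a div 2 + b div 2 + of_bool e'))))) (Add e)
      [(f0, h0), (word (map bit_sym B), int (length v)),
       (word (map bit_sym (v @ binary a)), int (length v)), (f3, h3)]
      Clear
      [(f0, h0), (word (map bit_sym B), int (length (v @ binary (a + b + of_bool e))) - 1),
       (word (map bit_sym (v @ binary (a + b + of_bool e))),
          int (length (v @ binary (a + b + of_bool e))) - 1), (f3, h3)]"
      by (rule run_step, simp, simp, rule step) (use IH update_v in \<open>simp add: add.commute\<close>)
    then show ?thesis
      unfolding sum by simp
  qed
qed

text \<open>The nonblank digits of the output guide the way left, and \<open>take j B\<close> is not
  yet erased; the blank left of the output ends the loop.\<close>

lemma clear:
  "j \<le> length V \<Longrightarrow>
   run (Suc j) Clear
     [(f0, h0), (word (take j B), int j - 1), (word (map bit_sym V), int j - 1), (f3, h3)]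
     Ascend [(f0, h0 - 1), (\<lambda>_. 0, 0), (word (map bit_sym V), 0), (f3, h3 - 1)]"
proof (induction j)
  case 0
  show ?case by (rule run_step) (auto simp: reach_refl)
next
  case (Suc j)
  show ?case by (rule run_step) (use Suc word_take_Suc in auto)
qed


lemma leaf:
  assumes S: "length S = n" "\<forall>(l, xs)\<in>set S. length l = length c0"
    and acc: "length (binary (acc + N (map fst S))) \<le> m"
    and bounds: "2 * n + 2 * length w + n * (length c0 + 2) + 2 * m + 8 \<le> b"
  shows "run b Rewind
     [(input_tape, int n - 1), (\<lambda>_. 0, 0), (word (map bit_sym (binary acc)), 0),
      (word (map symbol S), int n - 1)]
     Ascend
     [(input_tape, int n - 1), (\<lambda>_. 0, 0), (word (map bit_sym (binary (acc + N (map fst S)))), 0),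
      (word (map symbol S), int n - 1)]"
proof -
  let ?ls = "map fst S" and ?x = "binary (acc + N (map fst S))" and ?y = "binary (N (map fst S))"
  let ?q = "word (map bit_sym (w @ concat ?ls))" and ?S = "word (map symbol S)"
  let ?A = "word (map bit_sym (binary acc))"
  have len: "(\<Sum>(l, xs)\<leftarrow>S. length l + 2) = n * (length c0 + 2)"
  proof -
    have "(\<Sum>(l, xs)\<leftarrow>S. length l + 2) = (\<Sum>_\<leftarrow>S. length c0 + 2)"
      using S(2) by (intro arg_cong[of _ _ sum_list] map_cong) auto
    then show ?thesis by (simp add: sum_list_triv S(1))
  qed
  have ls: "length ?ls = n" "\<forall>l\<in>set ?ls. length l = length c0"
    using S by auto
  \<comment> \<open>The answer is no longer than the sum it enters, so clearing along the sum erases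
    all of it.\<close>
  have take: "take (length ?x) (map bit_sym ?y) = map bit_sym ?y"
    using length_binary_mono[of "N ?ls" "acc + N ?ls"] by simp
  have "n \<le> length w" by (simp add: input_word)
  \<comment> \<open>The eight phases are chained in order; each contributes one to the constant
    \<open>8\<close> in \<open>bounds\<close>.\<close>
  have "run (Suc n) Rewind
      [(input_tape, int n - 1), (\<lambda>_. 0, 0), (?A, 0), (?S, int n - 1)]
      Copy_Input [(input_tape, 0), (\<lambda>_. 0, 0), (?A, 0), (?S, 0)]"
    by (rule rewind) fact
  note reach_trans[OF this copy_input[of "[]" w, simplified]]
  note reach_trans[OF this, OF fetch[of S "input_tape" _ w _ _ "[]", simplified append_Nil list.size of_nat_0]]
  note reach_trans[OF this, OF return[OF le_refl]]
  note reach_trans[OF this, OF seek[of 0 n, simplified]]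
  note reach_trans[OF this, OF query[OF ls]]
  note reach_trans[OF this, OF add[of "[]" ?y "N ?ls" acc False, simplified]]
  note reach_trans[OF this, OF clear[of "length ?x" ?x _ _ "map bit_sym ?y", OF le_refl, simplified take]]
  from this[unfolded S(1)] show ?thesis
  proof (rule reach_mono)
    show "Suc n + Suc (length w) + Suc (\<Sum>(l, xs)\<leftarrow>S. length l + 2) + Suc (length w) + Suc n + 1 +
        Suc (length ?x) + Suc (length ?x) \<le> b"
      using bounds acc unfolding len by simp
  qed
qed


section \<open>Depth-first traversal\<close>

abbreviation config :: "int \<Rightarrow> (bool list \<times> branch list) list \<Rightarrow> nat \<Rightarrow> tape list" where
  "config h S acc \<equiv> [(input_tape, h), (\<lambda>_. 0, 0), (word (map bit_sym (binary acc)), 0),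
     (word (map symbol S), h)]"

text \<open>The stack and the blank oracle tape are restored, so sibling subtrees can be traversed
  in succession. The constant \<open>9\<close> is the \<open>8\<close> of \<open>leaf\<close> plus
  the \<open>Descend\<close> step.\<close>

lemma search_subtree:
  assumes "2 * n + 2 * length w + n * (length c0 + 2) + 2 * m + 9 \<le> b"
    and "length S + r = n" and "length x = length c0"
    and "\<forall>(l, xs)\<in>set S. length l = length c0"
    and "length (binary (acc + leaf_sum N r x (map fst S))) \<le> m"
  shows "run (search_time b r x) (Descend x) (config (int (length S)) S acc)
    Ascend (config (int (length S) - 1) S (acc + leaf_sum N r x (map fst S)))"
  using assms(2-)
proof (induction r arbitrary: x S acc)
  case 0
  obtain b' where b': "b = Suc b'" using assms(1) by (cases b) auto
  have read: "input_tape (int (length S)) = bit_sym False"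
    using 0 by (simp add: read_input del: word_nth)
  show ?case
  proof (cases "set x \<subseteq> {0}")
    case True
    then have "run b' Rewind (config (int (length S) - 1) S acc)
      Ascend (config (int (length S) - 1) S (acc + leaf_sum N 0 x (map fst S)))"
      using 0 assms(1) leaf[of S acc b'] by (simp add: b')
    then show ?thesis
      unfolding search_time.simps b'
      by (intro run_step) (use True in \<open>auto simp: read simp del: word_nth\<close>)
  next
    case False
    then show ?thesis
      unfolding search_time.simps b'
      by (intro run_step) (auto simp: read reach_refl simp del: word_nth)
  qed
next
  case (Suc r)
  let ?v = "int (length S)"
  \<comment> \<open>Generalised over the remaining branches \<open>xs\<close>, the running total
    \<open>a\<close> and the stale content \<open>s\<close> of the current stack cell, blank at
    first and \<open>symbol (l, xs)\<close> after a child; the next step overwrites it.\<close>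
  have sweep: "run (1 + (\<Sum>(l, x')\<leftarrow>xs. 2 + search_time b r x')) (Branch xs)
      [(input_tape, ?v), (\<lambda>_. 0, 0), (word (map bit_sym (binary a)), 0),
       ((word (map symbol S))(?v := s), ?v)]
      Ascend (config (?v - 1) S (a + (\<Sum>(l, x')\<leftarrow>xs. leaf_sum N r x' (map fst S @ [l]))))"
    if "\<forall>(l, x')\<in>set xs. length l = length c0 \<and> length x' = length c0"
      and "length (binary (a + (\<Sum>(l, x')\<leftarrow>xs. leaf_sum N r x' (map fst S @ [l])))) \<le> m"
    for xs a s
    using that
  proof (induction xs arbitrary: a s)
    case Nil
    show ?case by simp (rule run_step, auto simp: reach_refl)
  next
    case (Cons y xs)
    obtain l x' where y: "y = (l, x')" by fastforce
    let ?S = "S @ [(l, xs)]" and ?a = "a + leaf_sum N r x' (map fst S @ [l])"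
    let ?total = "?a + (\<Sum>(l, x')\<leftarrow>xs. leaf_sum N r x' (map fst S @ [l]))"
    have total: "length (binary ?total) \<le> m"
      using Cons.prems(2) by (simp add: y add.assoc)
    then have "length (binary ?a) \<le> m"
      using length_binary_mono[of ?a ?total] by simp
    then have "run (search_time b r x') (Descend x') (config (int (length ?S)) ?S a)
      Ascend (config (int (length ?S) - 1) ?S ?a)"
      using Suc.IH[of ?S x' a] Suc.prems Cons.prems(1) by (simp add: y)
    then have 1: "run (Suc (search_time b r x')) (Branch (y # xs))
      [(input_tape, ?v), (\<lambda>_. 0, 0), (word (map bit_sym (binary a)), 0),
       ((word (map symbol S))(?v := s), ?v)]
      Ascend (config ?v ?S ?a)"
      unfolding y by (intro run_step) (auto simp: add.commute)
    have 2: "run (Suc (1 + (\<Sum>(l, x')\<leftarrow>xs. 2 + search_time b r x'))) Ascend (config ?v ?S ?a)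
      Ascend (config (?v - 1) S ?total)"
      by (rule run_step) (use Cons.IH[of ?a "symbol (l, xs)"] Cons.prems(1) total in \<open>auto simp: nth_append\<close>)
    from reach_trans[OF 1 2] show ?case
      by (simp add: y add.assoc)
  qed
  have "run (1 + (\<Sum>(l, x')\<leftarrow>branches x. 2 + search_time b r x')) (Branch (branches x))
      (config ?v S acc)
      Ascend (config (?v - 1) S (acc + leaf_sum N (Suc r) x (map fst S)))"
    using sweep[of "branches x" acc 0] Suc.prems branches_length[of _ _ x] by auto
  moreover have "input_tape ?v = bit_sym True"
    using Suc.prems by (simp add: read_input del: word_nth)
  ultimately have "run (Suc (1 + (\<Sum>(l, x')\<leftarrow>branches x. 2 + search_time b r x'))) (Descend x)
      (config ?v S acc)
      Ascend (config (?v - 1) S (acc + leaf_sum N (Suc r) x (map fst S)))"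
    by (intro run_step) (auto simp del: word_nth)
  then show ?case by simp
qed

lemma search_computes:
  assumes "2 * n + 2 * length w + n * (length c0 + 2) + 2 * m + 9 \<le> b"
    and "length (binary (leaf_sum N n c0 [])) \<le> m"
  shows "computes_within (search_machine c0) Q w (leaf_sum N n c0 []) (Suc (search_time b n c0))"
proof -
  let ?a = "leaf_sum N n c0 []"
  have "run (search_time b n c0) (Descend c0) (config 0 [] 0) Ascend (config (- 1) [] ?a)"
    using search_subtree[OF assms(1), of "[]" n c0 0] assms(2) by simp
  moreover have "run 1 Ascend (config (- 1) [] ?a) Halt (config (- 1) [] ?a)"
    unfolding One_nat_def by (rule run_step) (auto simp: reach_refl)
  ultimately have "run (Suc (search_time b n c0)) (Descend c0) (config 0 [] 0) Halt (config (- 1) [] ?a)"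
    using reach_trans by fastforce
  moreover have "initial_configuration (search_machine c0) w = (to_nat (Descend c0), config 0 [] 0)"
    by (simp add: initial_configuration_def search_machine_def word_on_tape_eq binary.simps[of 0]
        numeral_eq_Suc)
  ultimately show ?thesis
    unfolding computes_within_def reach_def
    by (fastforce simp: search_machine_def word_on_tape_eq)
qed

end


section \<open>Counting by the search tree\<close>

definition label_set :: "'d list \<Rightarrow> bool list \<Rightarrow> 'd set" where
  "label_set ds l = {ds ! i |i. i < length ds \<and> l ! i}"

lemma nth_label_set:
  "distinct ds \<Longrightarrow> i < length ds \<Longrightarrow> ds ! i \<in> label_set ds l \<longleftrightarrow> l ! i"
  by (auto simp: label_set_def nth_eq_iff_index_eq)

text \<open>The functions fitting \<open>ls\<close> are split by their value \<open>ds ! j\<close>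
  at vertex \<open>length ls\<close>: they follow the free branch if \<open>c ! j = 0\<close> and
  otherwise the unit branch of \<open>j\<close>. The requirements then concern later vertices
  only.\<close>

lemma leaf_sum_eq_card:
  fixes F :: "(nat \<Rightarrow> 'd) set"
  assumes "distinct ds" and "finite F" and F: "\<And>f u. f \<in> F \<Longrightarrow> u < n \<Longrightarrow> f u \<in> set ds"
    and N: "\<And>ls. length ls = n \<Longrightarrow> N ls = card {f \<in> F. \<forall>u<n. f u \<in> label_set ds (ls ! u)}"
    and "length ls + r = n" and "length c = length ds"
  shows "leaf_sum N r c ls = card {f \<in> F. (\<forall>u<length ls. f u \<in> label_set ds (ls ! u)) \<and>
    (\<forall>i<length ds. c ! i \<le> card {u \<in> {length ls..<n}. f u = ds ! i})}"
  using assms(5,6)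
proof (induction r arbitrary: c ls)
  case 0
  define zero where "zero \<longleftrightarrow> (\<forall>i<length ds. c ! i = 0)"
  have "set c \<subseteq> {0} \<longleftrightarrow> zero"
    using 0 by (auto simp: zero_def in_set_conv_nth subset_iff)
  moreover have "(\<forall>i<length ds. c ! i \<le> card {u \<in> {length ls..<n}. f u = ds ! i}) \<longleftrightarrow> zero" for f
    using 0 by (simp add: zero_def)
  ultimately show ?case
    using 0 N[of ls] by simp
next
  case (Suc r)
  let ?v = "length ls" and ?k = "length ds"
  let ?count = "\<lambda>v f i. card {u \<in> {v..<n}. f u = ds ! i}"
  define A where "A l c' = {f \<in> F. (\<forall>u<length (ls @ [l]). f u \<in> label_set ds ((ls @ [l]) ! u)) \<and>
    (\<forall>i<?k. c' ! i \<le> ?count (length (ls @ [l])) f i)}" for l c'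
  define B where "B = {f \<in> F. (\<forall>u<?v. f u \<in> label_set ds (ls ! u)) \<and> (\<forall>i<?k. c ! i \<le> ?count ?v f i)}"
  define J where "J = {i. i < ?k \<and> 0 < c ! i}"
  define A0 where "A0 = A (free_label c) c"
  define A1 where "A1 i = A (unit_label ?k i) (c[i := c ! i - 1])" for i
  have A_iff: "f \<in> A l c' \<longleftrightarrow> f \<in> F \<and> (\<forall>u<?v. f u \<in> label_set ds (ls ! u)) \<and>
      f ?v \<in> label_set ds l \<and> (\<forall>i<?k. c' ! i \<le> ?count (Suc ?v) f i)" for f l c'
    by (auto simp: A_def nth_append less_Suc_eq)
  have count: "?count ?v f i = (if f ?v = ds ! i then 1 else 0) + ?count (Suc ?v) f i" for f i
  proof -
    have "{?v..<n} = insert ?v {Suc ?v..<n}" using Suc.prems by auto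
    then have "{u \<in> {?v..<n}. f u = ds ! i} =
        (if f ?v = ds ! i then {?v} else {}) \<union> {u \<in> {Suc ?v..<n}. f u = ds ! i}"
      by auto
    then show ?thesis by (simp add: card_Un_disjoint)
  qed
  have cases: "(f \<in> B \<longleftrightarrow> (if c ! j = 0 then f \<in> A0 else f \<in> A1 j)) \<and>
      (f \<in> A0 \<longrightarrow> c ! j = 0) \<and> (\<forall>i\<in>J. f \<in> A1 i \<longrightarrow> i = j)"
    if "f \<in> F" "j < ?k" "f ?v = ds ! j" for f j
  proof -
    have eq: "ds ! j = ds ! i \<longleftrightarrow> j = i" if "i < ?k" for i
      using that \<open>j < ?k\<close> assms(1) by (simp add: nth_eq_iff_index_eq)
    have free: "f ?v \<in> label_set ds (free_label c) \<longleftrightarrow> c ! j = 0"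
      using that Suc.prems by (simp add: nth_label_set[OF assms(1)] free_label_def)
    have unit: "f ?v \<in> label_set ds (unit_label ?k i) \<longleftrightarrow> i = j" for i
      using that by (auto simp: nth_label_set[OF assms(1)] unit_label_def)
    \<comment> \<open>The current vertex counts only towards \<open>ds ! j\<close>, whose
      requirement is already \<open>0\<close>.\<close>
    have "(\<forall>i<?k. c ! i \<le> ?count ?v f i) \<longleftrightarrow> (\<forall>i<?k. c ! i \<le> ?count (Suc ?v) f i)" if "c ! j = 0"
    proof -
      have "c ! i \<le> ?count ?v f i \<longleftrightarrow> c ! i \<le> ?count (Suc ?v) f i" if "i < ?k" for i
        using eq[OF that] \<open>c ! j = 0\<close> \<open>f ?v = ds ! j\<close> unfolding count by auto
      then show ?thesis by blast
    qed
    \<comment> \<open>Leaving out the current vertex lowers the count for \<open>ds ! j\<close> by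
      one, just as the unit branch lowers its requirement.\<close>
    moreover have "(\<forall>i<?k. c ! i \<le> ?count ?v f i) \<longleftrightarrow>
        (\<forall>i<?k. c[j := c ! j - 1] ! i \<le> ?count (Suc ?v) f i)" if "0 < c ! j"
    proof -
      have "c ! i \<le> ?count ?v f i \<longleftrightarrow> c[j := c ! j - 1] ! i \<le> ?count (Suc ?v) f i" if "i < ?k" for i
        using eq[OF that] \<open>0 < c ! j\<close> \<open>f ?v = ds ! j\<close> \<open>j < ?k\<close> Suc.prems
        unfolding count by (auto simp: nth_list_update)
      then show ?thesis by blast
    qed
    ultimately show ?thesis
      using \<open>f \<in> F\<close> by (auto simp: A0_def A1_def A_iff B_def free unit)
  qed
  have index: "\<exists>j<?k. f ?v = ds ! j" if "f \<in> F" for f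
    using F[OF that, of ?v] Suc.prems by (auto simp: in_set_conv_nth)
  have sub: "A0 \<subseteq> F" "A1 i \<subseteq> F" for i
    by (auto simp: A0_def A1_def A_def)
  have fin: "finite A0" "finite (A1 i)" for i
    using sub assms(2) finite_subset by blast+
  have "B \<subseteq> F" by (auto simp: B_def)
  have B: "B = A0 \<union> (\<Union>i\<in>J. A1 i)"
  proof (intro set_eqI)
    fix f
    show "f \<in> B \<longleftrightarrow> f \<in> A0 \<union> (\<Union>i\<in>J. A1 i)"
    proof (cases "f \<in> F")
      case True
      then obtain j where j: "j < ?k" "f ?v = ds ! j" using index by blast
      show ?thesis
        using cases[OF True j] j(1) by (auto simp: J_def)
    qed (use sub \<open>B \<subseteq> F\<close> in blast)
  qed
  have "A0 \<inter> (\<Union>i\<in>J. A1 i) = {}"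
  proof (rule ccontr)
    assume "A0 \<inter> (\<Union>i\<in>J. A1 i) \<noteq> {}"
    then obtain f i where f: "f \<in> A0" "i \<in> J" "f \<in> A1 i" by blast
    then obtain j where j: "j < ?k" "f ?v = ds ! j" using index sub by blast
    show False using cases[OF subsetD[OF sub(1) f(1)] j] f by (auto simp: J_def)
  qed
  moreover have "\<forall>i\<in>J. \<forall>i'\<in>J. i \<noteq> i' \<longrightarrow> A1 i \<inter> A1 i' = {}"
  proof (intro ballI impI, rule ccontr)
    fix i i' assume i: "i \<in> J" "i' \<in> J" "i \<noteq> i'" "A1 i \<inter> A1 i' \<noteq> {}"
    then obtain f where f: "f \<in> A1 i" "f \<in> A1 i'" by blast
    then obtain j where j: "j < ?k" "f ?v = ds ! j" using index sub by blast
    show False using cases[of f j] j f sub i by blast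
  qed
  ultimately have "card B = card A0 + (\<Sum>i\<in>J. card (A1 i))"
    unfolding B using fin by (subst card_Un_disjoint) (auto simp: J_def card_UN_disjoint)
  moreover have "leaf_sum N r c' (ls @ [l]) = card (A l c')" if "length c' = ?k" for l c'
    unfolding A_def using Suc.IH[of "ls @ [l]" c'] Suc.prems that by simp
  moreover have "J = set (filter (\<lambda>i. 0 < c ! i) [0..<?k])"
    by (auto simp: J_def)
  ultimately show ?case
    unfolding B_def[symmetric] using Suc.prems
    by (simp add: branches_def A0_def A1_def comp_def sum.distinct_set_conv_list del: set_filter)
qed


section \<open>The reduction\<close>

text \<open>Characteristic vectors survive decoding and encoding because
  \<open>enumeration D\<close> is distinct, so the stack labels already spell the lists of the
  query. Restriction to \<open>{..<n}\<close> makes the map extensional, as instances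
  demand.\<close>

lemma encode_lists_label_set:
  assumes "finite D" and "length ls = n" and "\<forall>l\<in>set ls. length l = length (enumeration D)"
  shows "encode_lists D n (\<lambda>v\<in>{..<n}. label_set (enumeration D) (ls ! v)) = concat ls"
proof -
  have "map (\<lambda>d. d \<in> label_set (enumeration D) (ls ! v)) (enumeration D) = ls ! v" if "v < n" for v
    using that assms nth_label_set[OF enumeration(1)[OF assms(1)]]
    by (intro nth_equalityI) auto
  then have "map (\<lambda>v. map (\<lambda>d. d \<in> (\<lambda>v\<in>{..<n}. label_set (enumeration D) (ls ! v)) v) (enumeration D))
      [0..<n] = ls"
    using assms(2) by (intro nth_equalityI) auto
  then show ?thesis by (simp only: encode_lists_def)
qed

theorem proposition28:
  fixes D :: "'d set" and M :: "'d \<Rightarrow> 'd \<Rightarrow> entry" and C :: "'d \<Rightarrow> nat"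
  assumes "finite D" and "symmetric_matrix D M"
  shows "poly_time_Turing_reducible (C_M_partitions D C M) (List_M_partitions D M)"
proof -
  define ds where "ds = enumeration D"
  define k where "k = length ds"
  define c0 where "c0 = map C ds"
  define s where "s = sum_list c0"
  \<comment> \<open>The bound of \<open>search_time_le\<close> at input length \<open>x\<close>,
    with \<open>(3 * k + 6) * x + 11\<close> for \<open>B\<close> and \<open>x\<close> for
    \<open>r\<close>, plus one step to \<open>Halt\<close>.\<close>
  define p :: "nat poly" where
    "p = [:2 * k + 15, 3 * k + 6:] * ([:1, 1:] ^ Suc s * [:(k + 1) ^ s:]) + 1"
  have ds: "distinct ds" "set ds = D"
    using enumeration[OF assms(1)] by (simp_all add: ds_def)
  have k: "length c0 = k" "card D = k"
    using distinct_card[OF ds(1)] by (simp_all add: c0_def k_def ds(2))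
  have "computes_within (search_machine c0) (List_M_partitions D M) (encode (C_M_partitions D C M) G)
      (solution_count (C_M_partitions D C M) G) (poly p (length (encode (C_M_partitions D C M) G)))"
    if "G \<in> instances (C_M_partitions D C M)" for G
  proof -
    have G: "G \<in> input_graphs" using that by (simp add: C_M_partitions_def)
    then obtain n where n: "pverts G = {..<n}" by (auto simp: input_graphs_def)
    define w where "w = encode_graph G"
    define rest where "rest = map (\<lambda>e. e \<in> parcs G) (List.product [0..<n] [0..<n])"
    define F where "F = {\<sigma>. M_partition D M G \<sigma>}"
    define L where "L ls = (\<lambda>v\<in>{..<n}. label_set ds (ls ! v))" for ls
    define N where "N ls = card {\<sigma> \<in> F. \<forall>u<n. \<sigma> u \<in> label_set ds (ls ! u)}" for ls
    \<comment> \<open>There are at most \<open>k ^ n \<le> 2 ^ (k * n)\<close> many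
      \<open>M\<close>-partitions, so \<open>k * n + 1\<close> digits suffice.\<close>
    define m where "m = k * n + 1"
    \<comment> \<open>Since \<open>n \<le> length w\<close>, this dominates the leaf cost
      \<open>n * (3 * k + 4) + 2 * length w + 11\<close>.\<close>
    define b where "b = (3 * k + 6) * length w + 11"
    have w: "w = replicate n True @ False # rest"
      by (simp add: w_def encode_graph_def n rest_def)
    have "F \<subseteq> {..<n} \<rightarrow>\<^sub>E D"
      by (auto simp: F_def M_partition_def n)
    then have fin: "finite F" and "card F \<le> k ^ n"
      using card_mono[of "{..<n} \<rightarrow>\<^sub>E D" F] assms(1)
      by (auto simp: finite_PiE card_PiE k intro: finite_subset)
    interpret search c0 "List_M_partitions D M" w rest n m N
    proof
      fix ls :: "bool list list"
      assume ls: "length ls = n" "\<forall>l\<in>set ls. length l = length c0"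
      have "L ls \<in> {..<n} \<rightarrow>\<^sub>E Pow D"
        using ds(2) by (auto simp: L_def label_set_def)
      then have "(G, L ls) \<in> instances (List_M_partitions D M)"
        using G by (simp add: List_M_partitions_def n)
      moreover have "encode (List_M_partitions D M) (G, L ls) = w @ concat ls"
        using encode_lists_label_set[OF assms(1) ls(1)] ls(2)
        by (simp add: List_M_partitions_def n w_def L_def ds_def c0_def)
      moreover have "solution_count (List_M_partitions D M) (G, L ls) = N ls"
        by (simp add: List_M_partitions_def respects_lists_def N_def F_def n L_def Ball_def)
      ultimately show "\<exists>y\<in>instances (List_M_partitions D M).
          encode (List_M_partitions D M) y = w @ concat ls \<and>
          solution_count (List_M_partitions D M) y = N ls"
        by blast
    qed (rule w)
    have "leaf_sum N n c0 [] =
        card {\<sigma> \<in> F. \<forall>i<length ds. c0 ! i \<le> card {u \<in> {0..<n}. \<sigma> u = ds ! i}}"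
      by (subst leaf_sum_eq_card[OF ds(1) fin, where n = n])
        (use \<open>F \<subseteq> {..<n} \<rightarrow>\<^sub>E D\<close> ds(2) in \<open>auto simp: N_def c0_def\<close>)
    also have "{\<sigma> \<in> F. \<forall>i<length ds. c0 ! i \<le> card {u \<in> {0..<n}. \<sigma> u = ds ! i}} =
        {\<sigma>. M_partition D M G \<sigma> \<and> satisfies_constraint D G C \<sigma>}"
      by (simp add: F_def satisfies_constraint_def n c0_def atLeast0LessThan all_set_conv_all_nth
          flip: ds(2))
    finally have total: "leaf_sum N n c0 [] = solution_count (C_M_partitions D C M) G"
      by (simp add: C_M_partitions_def)
    have "leaf_sum N n c0 [] \<le> card F"
      unfolding total using fin by (auto simp: C_M_partitions_def F_def intro!: card_mono)
    also have "\<dots> \<le> (2 ^ k) ^ n"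
      using \<open>card F \<le> k ^ n\<close> power_mono[of k "2 ^ k" n] less_exp[of k] by simp
    also have "\<dots> < 2 ^ m"
      by (simp add: m_def power_mult)
    finally have "length (binary (leaf_sum N n c0 [])) \<le> m"
      by (simp add: length_binary_le_iff)
    moreover have "n \<le> length w" by (simp add: w)
    then have "n * (3 * k + 4) \<le> length w * (3 * k + 4)"
      by (rule mult_right_mono) simp
    then have "2 * n + 2 * length w + n * (length c0 + 2) + 2 * m + 9 \<le> b"
      by (simp add: m_def b_def k algebra_simps)
    ultimately have "computes_within (search_machine c0) (List_M_partitions D M) w
        (solution_count (C_M_partitions D C M) G) (Suc (search_time b n c0))"
      using search_computes unfolding total by blast
    moreover have "Suc (search_time b n c0) \<le> poly p (length w)"
    proof -
      have "search_time b n c0 \<le> (b + 2 * k + 4) * ((n + 1) ^ Suc s * (k + 1) ^ s)"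
        using search_time_le[OF k(1)] by (simp add: s_def)
      also have "\<dots> \<le> (b + 2 * k + 4) * ((length w + 1) ^ Suc s * (k + 1) ^ s)"
        using \<open>n \<le> length w\<close> by (intro mult_left_mono mult_right_mono power_mono) auto
      also have "\<dots> + 1 = poly p (length w)"
        by (simp add: p_def b_def algebra_simps)
      finally show ?thesis by simp
    qed
    ultimately show ?thesis
      by (auto simp: computes_within_def C_M_partitions_def w_def intro: le_trans)
  qed
  then show ?thesis
    using wf_search_machine unfolding poly_time_Turing_reducible_def by blast
qed

end
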